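(* (1) A regular tetrahedron in $\mathbb{R}^3$ with edge length $a=2$ has base area $A=\sqrt{3}\approx 1.73205$, height $h=\frac{2}{3}\sqrt{6}\approx 1.63299$ and volume $V=\frac{2}{3}\sqrt{2}\approx 0.94281$. (2) The icosahedral tetrahedron, with base edge length $a=\frac{8}{\sqrt{10+2\sqrt{5}}}\approx 2.1029$, has base area $$A=\frac{\sqrt{3}}{4}\left(\frac{8}{\sqrt{10+2\sqrt{5}}}\right)^2\approx 1.91491,$$ height $$h=\frac{2\sqrt{3}\,(3+\sqrt{5})}{3\sqrt{10+2\sqrt{5}}}\approx 1.58931$$ and volume $$V=\frac{1}{3}\cdot\frac{\sqrt{3}}{4}\left(\frac{8}{\sqrt{10+2\sqrt{5}}}\right)^2\cdot\frac{2\sqrt{3}\,(3+\sqrt{5})}{3\sqrt{10+2\sqrt{5}}}\approx 1.01446 .$$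
   Context: All spheres are unit spheres (radius $1$) in Euclidean space $\mathbb{R}^3$. In the icosahedral configuration, twelve unit spheres touch a central unit sphere in such a way that their centers are the vertices of a regular icosahedron whose center is the center of the central sphere; thus this icosahedron has circumsphere radius $2$. An icosahedral tetrahedron is a tetrahedron with one vertex at the center of the central sphere and the other three vertices at the centers of three mutually neighboring touching spheres, i.e. at the three vertices of one triangular face of the icosahedron. Its base is this equilateral triangular face, its base edge length is the edge length of that face (the edge length of the icosahedron), and its height is the distance from the center of the central sphere to the plane of that face. For the regular tetrahedron, the base is any of its faces and the height is the distance from the opposite vertex to the plane of that face. The symbol $\approx$ denotes rounding to the displayed number of decimal places. *)

theory Defs
  imports "HOL-Analysis.Analysis"
begin

definition regular_simplex :: "int \<Rightarrow> real \<Rightarrow> (real^3) set \<Rightarrow> bool" where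
  "regular_simplex n a S \<longleftrightarrow>
     (\<exists>C. \<not> affine_dependent C \<and> int (card C) = n + 1 \<and> S = convex hull C \<and>
          (\<forall>x\<in>C. \<forall>y\<in>C. x \<noteq> y \<longrightarrow> dist x y = a))"

definition regular_tetrahedron :: "real \<Rightarrow> (real^3) set \<Rightarrow> bool" where
  "regular_tetrahedron a T \<longleftrightarrow> regular_simplex 3 a T"

definition equilateral_triangle :: "real \<Rightarrow> (real^3) set \<Rightarrow> bool" where
  "equilateral_triangle a F \<longleftrightarrow> regular_simplex 2 a F"

text \<open>The Platonic solid: a convex polyhedron whose faces are congruent equilateral triangles,
  five of which meet at every vertex.\<close>

definition regular_icosahedron :: "(real^3) set \<Rightarrow> bool" where
  "regular_icosahedron P \<longleftrightarrow>
     polytope P \<and> aff_dim P = 3 \<and>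
     (\<exists>a. \<forall>F. F facet_of P \<longrightarrow> equilateral_triangle a F) \<and>
     (\<forall>v. v extreme_point_of P \<longrightarrow> card {F. F facet_of P \<and> v \<in> F} = 5)"

definition unit_spheres_touch :: "real^3 \<Rightarrow> real^3 \<Rightarrow> bool" where
  "unit_spheres_touch x y \<longleftrightarrow> sphere x 1 \<inter> sphere y 1 \<noteq> {} \<and> ball x 1 \<inter> ball y 1 = {}"

text \<open>The touching condition puts all vertices of \<open>P\<close> at distance 2 from \<open>c\<close>; this is what
  makes \<open>c\<close> the centre (circumcentre) of the icosahedron.\<close>

definition icosahedral_configuration :: "real^3 \<Rightarrow> (real^3) set \<Rightarrow> bool" where
  "icosahedral_configuration c P \<longleftrightarrow>
     regular_icosahedron P \<and> card {v. v extreme_point_of P} = 12 \<and>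
     (\<forall>v. v extreme_point_of P \<longrightarrow> unit_spheres_touch c v)"

definition icosahedral_tetrahedron ::
    "real^3 \<Rightarrow> (real^3) set \<Rightarrow> (real^3) set \<Rightarrow> bool" where
  "icosahedral_tetrahedron c F T \<longleftrightarrow>
     (\<exists>P. icosahedral_configuration c P \<and> F facet_of P \<and>
          T = convex hull (insert c {v. v extreme_point_of F}))"

text \<open>Two-dimensional Lebesgue measure of a subset of a plane in space, transported to the
  Euclidean plane by an isometric parametrization; the value does not depend on the
  parametrization. Meaningful only for sets contained in a plane.\<close>

definition planar_area :: "(real^3) set \<Rightarrow> real" where
  "planar_area S =
     (THE A. \<exists>f :: real^2 \<Rightarrow> real^3.
        (\<forall>x y. dist (f x) (f y) = dist x y) \<and> S \<subseteq> range f \<and> A = measure lebesgue (f -` S))"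

definition solid_volume :: "(real^3) set \<Rightarrow> real" where
  "solid_volume T = measure lebesgue T"

definition height_above :: "real^3 \<Rightarrow> (real^3) set \<Rightarrow> real" where
  "height_above p F = infdist p (affine hull F)"

text \<open>\<open>y\<close> is \<open>x\<close> rounded to \<open>d\<close> decimal places.\<close>

definition rounds_to :: "nat \<Rightarrow> real \<Rightarrow> real \<Rightarrow> bool" where
  "rounds_to d x y \<longleftrightarrow> of_int (round (10 ^ d * x)) = 10 ^ d * y"

end

theory Submission
  imports Defs
begin

text \<open>Both tetrahedra are pyramids over an equilateral triangle of side \<open>a\<close> whose apex has the same
  distance \<open>d\<close> from the three base vertices. Such a pyramid has base area \<open>sqrt 3 / 4 * a\<^sup>2\<close> (Heron),
  height \<open>sqrt (d\<^sup>2 - a\<^sup>2 / 3)\<close> (the foot is the centroid) and volume one third of their product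
  (a Gram determinant): \<open>planar_area_equilateral\<close>, \<open>height_above_equilateral\<close>,
  \<open>solid_volume_equilateral_base\<close>. The regular tetrahedron has \<open>a = d = 2\<close>, and the icosahedral one
  has \<open>d = 2\<close> because the spheres around \<open>c\<close> and around each vertex touch.

  What remains is the edge length of the icosahedron, which is given only as a convex polytope with
  congruent equilateral facets, five at each vertex, and vertices on a sphere around \<open>c\<close>. It is
  determined locally. The five facets at a vertex close up to a single cycle
  (\<open>five_edges_form_pentagon\<close>), because every edge lies in at least two facets
  (\<open>edge_in_further_facet\<close>) and, on a sphere, in at most two (\<open>apexes_over_edge_sum\<close>). So the five
  neighbours of a vertex lie on a circle and form an equilateral closed pentagon there, either convex
  or a pentagram. A supporting plane of a facet excludes the pentagram, and the convex pentagon forces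
  the vectors from \<open>c\<close> to adjacent vertices to have inner product \<open>4 / sqrt 5\<close>
  (\<open>pentagonal_link_inner\<close>), that is \<open>a\<^sup>2 = 8 - 8 / sqrt 5\<close>.\<close>

section \<open>Pyramids over an equilateral triangle\<close>

text \<open>After subtracting \<open>f 0\<close>, an isometry \<open>g\<close> preserves norms and by polarization inner products; expanding
  \<open>\<parallel>g (x + y) - g x - g y\<parallel>\<^sup>2\<close> then gives zero. Domain and codomain may differ: the maps of
  interest parametrize a plane in space.\<close>

lemma isometry_imp_linear_diff:
  fixes f :: "'a::real_inner \<Rightarrow> 'b::real_inner"
  assumes iso: "\<And>x y. dist (f x) (f y) = dist x y"
  shows "linear (\<lambda>x. f x - f 0)"
proof -
  define g where "g = (\<lambda>x. f x - f 0)"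
  have nrm: "norm (g x) = norm x" for x
    using iso[of x 0] by (simp add: g_def dist_norm)
  have nrmd: "norm (g x - g y) = norm (x - y)" for x y
    using iso[of x y] by (simp add: g_def dist_norm)
  have inn: "g x \<bullet> g y = x \<bullet> y" for x y
    by (simp add: dot_norm_neg nrm nrmd)
  have "(g (x + y) - g x - g y) \<bullet> (g (x + y) - g x - g y) = 0" for x y
    by (simp add: inner_diff_left inner_diff_right inn inner_add_left inner_add_right)
  then have add: "g (x + y) = g x + g y" for x y
    by (metis inner_eq_zero_iff diff_diff_eq eq_iff_diff_eq_0)
  have "(g (r *\<^sub>R x) - r *\<^sub>R g x) \<bullet> (g (r *\<^sub>R x) - r *\<^sub>R g x) = 0" for r x
    by (simp add: inner_diff_left inner_diff_right inn)
  then have "g (r *\<^sub>R x) = r *\<^sub>R g x" for r x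
    by (metis inner_eq_zero_iff eq_iff_diff_eq_0)
  with add have "linear g" by (intro linearI)
  then show ?thesis by (simp add: g_def)
qed

lemma convex_hull_isometry_image:
  fixes f :: "'a::real_inner \<Rightarrow> 'b::real_inner"
  assumes iso: "\<And>x y. dist (f x) (f y) = dist x y"
  shows "convex hull (f ` S) = f ` (convex hull S)"
proof -
  define g where "g = (\<lambda>x. f x - f 0)"
  have "linear g" unfolding g_def by (rule isometry_imp_linear_diff[OF iso])
  have im: "f ` A = (+) (f 0) ` (g ` A)" for A by (auto simp: g_def image_image)
  show ?thesis
    unfolding im convex_hull_translation convex_hull_linear_image[OF \<open>linear g\<close>] ..
qed

text \<open>Any isometric parametrization of the plane pulls the triangle back to one with the same side
  lengths, so Heron's formula gives the same value for all of them; this is the uniqueness that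
  the definite description in \<open>planar_area\<close> asks for. Existence needs one explicit parametrization.\<close>

lemma planar_area_equilateral:
  fixes x y z :: "real^3"
  assumes a: "a > 0" and xy: "dist x y = a" and yz: "dist y z = a" and xz: "dist x z = a"
  shows "planar_area (convex hull {x, y, z}) = sqrt 3 / 4 * a\<^sup>2"
proof -
  have area: "measure lebesgue (f -` (convex hull {x, y, z})) = sqrt 3 / 4 * a\<^sup>2"
    if iso: "\<And>u v. dist (f u) (f v) = dist u v" and XYZ: "x = f X" "y = f Y" "z = f Z"
    for f :: "real^2 \<Rightarrow> real^3" and X Y Z
  proof -
    have "inj f" using iso by (metis dist_eq_0_iff injI)
    have "convex hull {x, y, z} = f ` (convex hull {X, Y, Z})"
      using convex_hull_isometry_image[OF iso, of "{X, Y, Z}"] by (simp add: XYZ)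
    then have "measure lebesgue (f -` (convex hull {x, y, z})) = measure lebesgue (convex hull {X, Y, Z})"
      by (simp add: inj_vimage_image_eq[OF \<open>inj f\<close>])
    also have "\<dots> = measure lborel (convex hull {X, Y, Z})"
      by (intro measure_completion) (simp add: borel_compact finite_imp_compact_convex_hull)
    also have "\<dots> = sqrt ((a+a+a)/2 * ((a+a+a)/2 - a) * ((a+a+a)/2 - a) * ((a+a+a)/2 - a))"
      unfolding heron using xy yz xz by (simp add: XYZ iso)
    also have "\<dots> = sqrt (3 * (a\<^sup>2 / 4)\<^sup>2)"
      by (simp add: power2_eq_square field_simps)
    also have "\<dots> = sqrt 3 / 4 * a\<^sup>2"
      by (simp add: real_sqrt_mult)
    finally show ?thesis .
  qed
  \<comment> \<open>An orthonormal frame at \<open>x\<close>, by Gram--Schmidt on the two sides there, parametrizes the plane.\<close>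
  define U V where "U = y - x" and "V = z - x"
  define e1 where "e1 = (1 / a) *\<^sub>R U"
  define e2 where "e2 = (1 / (sqrt 3 * a)) *\<^sub>R (2 *\<^sub>R V - U)"
  define f :: "real^2 \<Rightarrow> real^3" where "f = (\<lambda>v. x + (v$1) *\<^sub>R e1 + (v$2) *\<^sub>R e2)"
  have UV: "U \<bullet> U = a\<^sup>2" "V \<bullet> V = a\<^sup>2" "(V - U) \<bullet> (V - U) = a\<^sup>2"
    using xy yz xz by (simp_all add: U_def V_def dist_norm norm_minus_commute flip: power2_norm_eq_inner)
  then have "U \<bullet> V = a\<^sup>2 / 2" "V \<bullet> U = a\<^sup>2 / 2"
    by (auto simp: inner_diff_left inner_diff_right inner_commute)
  with UV a have e: "e1 \<bullet> e1 = 1" "e1 \<bullet> e2 = 0" "e2 \<bullet> e2 = 1"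
    by (auto simp: e1_def e2_def inner_diff_left inner_diff_right field_simps power2_eq_square)
  have iso: "dist (f u) (f v) = dist u v" for u v
  proof -
    have "(dist (f u) (f v))\<^sup>2 = (u$1 - v$1)\<^sup>2 + (u$2 - v$2)\<^sup>2"
    proof -
      have "f u - f v = (u$1 - v$1) *\<^sub>R e1 + (u$2 - v$2) *\<^sub>R e2"
        by (simp add: f_def algebra_simps)
      then show ?thesis
        unfolding dist_norm power2_norm_eq_inner
        by (simp add: inner_add_left inner_add_right e
            inner_commute[of e2 e1] power2_eq_square)
    qed
    also have "\<dots> = (dist u v)\<^sup>2"
      unfolding dist_norm power2_norm_eq_inner by (simp add: inner_vec_def sum_2 power2_eq_square)
    finally show ?thesis by simp
  qed
  have fx: "x = f 0" by (simp add: f_def)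
  have fy: "y = f (vector [a, 0])" using a by (simp add: f_def e1_def U_def)
  have fz: "z = f (vector [a/2, sqrt 3 * a/2])"
  proof -
    have "f (vector [a/2, sqrt 3 * a/2]) = x + (1/2) *\<^sub>R (y - x) + (1/2) *\<^sub>R (2 *\<^sub>R (z - x) - (y - x))"
      using a by (simp add: f_def e1_def e2_def U_def V_def)
    also have "\<dots> = z" by (simp add: vec_eq_iff field_simps)
    finally show ?thesis by simp
  qed
  obtain X Y Z where XYZ: "x = f X" "y = f Y" "z = f Z" by (rule that[OF fx fy fz])
  have ran: "convex hull {x, y, z} \<subseteq> range f"
    using convex_hull_isometry_image[OF iso, of "{X, Y, Z}"] by (auto simp: XYZ)
  show ?thesis
    unfolding planar_area_def
  proof (rule the_equality)
    show "\<exists>f :: real^2 \<Rightarrow> real^3. (\<forall>x y. dist (f x) (f y) = dist x y) \<and>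
      convex hull {x, y, z} \<subseteq> range f \<and>
      sqrt 3 / 4 * a\<^sup>2 = measure lebesgue (f -` (convex hull {x, y, z}))"
      using iso ran area[OF iso XYZ] by (intro exI[of _ f]) simp
  next
    fix A
    assume "\<exists>f :: real^2 \<Rightarrow> real^3. (\<forall>x y. dist (f x) (f y) = dist x y) \<and>
      convex hull {x, y, z} \<subseteq> range f \<and> A = measure lebesgue (f -` (convex hull {x, y, z}))"
    then obtain g :: "real^2 \<Rightarrow> real^3" where g: "\<And>u v. dist (g u) (g v) = dist u v"
      and ran: "convex hull {x, y, z} \<subseteq> range g"
      and A: "A = measure lebesgue (g -` (convex hull {x, y, z}))" by blast
    have "x \<in> range g" "y \<in> range g" "z \<in> range g"
      using ran hull_subset[of "{x, y, z}" convex] by (simp_all add: subset_iff)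
    then obtain X Y Z where "x = g X" "y = g Y" "z = g Z"
      unfolding image_iff by meson
    then show "A = sqrt 3 / 4 * a\<^sup>2" unfolding A by (rule area[OF g])
  qed
qed

text \<open>A point equidistant from the three vertices projects orthogonally to the centroid, which lies
  at distance \<open>a / sqrt 3\<close> from each vertex.\<close>

lemma height_above_equilateral:
  fixes p x y z :: "real^3"
  assumes xy: "dist x y = a" and yz: "dist y z = a" and xz: "dist x z = a"
    and px: "dist p x = d" and py: "dist p y = d" and pz: "dist p z = d"
  shows "height_above p (convex hull {x, y, z}) = sqrt (d\<^sup>2 - a\<^sup>2 / 3)"
proof -
  define m where "m = (1/3) *\<^sub>R (x + y + z)"
  have ip: "(x - p) \<bullet> (x - p) = d\<^sup>2" "(y - p) \<bullet> (y - p) = d\<^sup>2" "(z - p) \<bullet> (z - p) = d\<^sup>2"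
    "(y - x) \<bullet> (y - x) = a\<^sup>2" "(z - x) \<bullet> (z - x) = a\<^sup>2" "(z - y) \<bullet> (z - y) = a\<^sup>2"
    using assms by (metis dist_norm dist_commute power2_norm_eq_inner)+
  define X Y Z where "X = x - p" and "Y = y - p" and "Z = z - p"
  have sub: "x - p = X" "y - p = Y" "z - p = Z" "y - x = Y - X" "z - x = Z - X" "z - y = Z - Y"
    by (simp_all add: X_def Y_def Z_def)
  have gram: "X \<bullet> X = d\<^sup>2" "Y \<bullet> Y = d\<^sup>2" "Z \<bullet> Z = d\<^sup>2"
    "X \<bullet> Y = d\<^sup>2 - a\<^sup>2/2" "X \<bullet> Z = d\<^sup>2 - a\<^sup>2/2" "Y \<bullet> Z = d\<^sup>2 - a\<^sup>2/2"
    "Y \<bullet> X = d\<^sup>2 - a\<^sup>2/2" "Z \<bullet> X = d\<^sup>2 - a\<^sup>2/2" "Z \<bullet> Y = d\<^sup>2 - a\<^sup>2/2"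
    using ip unfolding sub
    by (auto simp: inner_diff_left inner_diff_right inner_commute)
  have m: "m - p = (1/3) *\<^sub>R (X + Y + Z)"
    by (simp add: m_def X_def Y_def Z_def vec_eq_iff field_simps)
  have dpm: "dist p m = norm (m - p)" by (simp add: dist_norm norm_minus_commute)
  have hyp: "dist p m = sqrt (d\<^sup>2 - a\<^sup>2 / 3)"
  proof -
    have "(dist p m)\<^sup>2 = d\<^sup>2 - a\<^sup>2 / 3"
      unfolding dpm power2_norm_eq_inner m
      by (simp add: inner_add_left inner_add_right gram field_simps)
    then show ?thesis by (metis real_sqrt_unique zero_le_dist)
  qed
  have m_in: "m \<in> affine hull {x, y, z}"
    unfolding affine_hull_3 m_def
    by (auto intro!: exI[of _ "1/3"] simp: scaleR_add_right)
  have far: "dist p m \<le> dist p q" if q_in: "q \<in> affine hull {x, y, z}" for q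
  proof -
    obtain u v w where q: "q = u *\<^sub>R x + v *\<^sub>R y + w *\<^sub>R z" and s: "u + v + w = 1"
      using q_in unfolding affine_hull_3 by blast
    have qp: "q - p = u *\<^sub>R X + v *\<^sub>R Y + w *\<^sub>R Z"
    proof -
      have "p = (u + v + w) *\<^sub>R p" using s by simp
      then show ?thesis unfolding q X_def Y_def Z_def by (simp add: algebra_simps)
    qed
    \<comment> \<open>Every point of the plane has the same inner product with \<open>m - p\<close>, since \<open>m - p\<close> is normal to it.\<close>
    have "(m - p) \<bullet> (q - p) = (u + v + w) * (d\<^sup>2 - a\<^sup>2/3)"
      unfolding m qp by (simp add: inner_add_left inner_add_right gram field_simps)
    moreover have "(m - p) \<bullet> (m - p) = d\<^sup>2 - a\<^sup>2 / 3"
      unfolding m by (simp add: inner_add_left inner_add_right gram field_simps)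
    ultimately have "(norm (m - p))\<^sup>2 = (m - p) \<bullet> (q - p)"
      using s by (simp add: power2_norm_eq_inner)
    also have "\<dots> \<le> norm (m - p) * norm (q - p)" by (rule norm_cauchy_schwarz)
    finally have "norm (m - p) \<le> norm (q - p)"
      by (cases "norm (m - p) = 0") (auto simp: power2_eq_square)
    then show ?thesis by (simp add: dist_norm norm_minus_commute)
  qed
  have "infdist p (affine hull {x, y, z}) = dist p m"
    using m_in far by (intro antisym infdist_le) (auto simp: infdist_def intro!: cINF_greatest)
  then show ?thesis by (simp add: height_above_def hyp affine_hull_convex_hull)
qed

lemma gram_det_3:
  fixes u v w :: "real^3"
  shows "(det (\<chi> i j. (if j = 1 then u else if j = 2 then v else w) $ i))\<^sup>2 =
    (u \<bullet> u) * (v \<bullet> v) * (w \<bullet> w) + 2 * (u \<bullet> v) * (v \<bullet> w) * (u \<bullet> w)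
      - (u \<bullet> u) * (v \<bullet> w)\<^sup>2 - (v \<bullet> v) * (u \<bullet> w)\<^sup>2 - (w \<bullet> w) * (u \<bullet> v)\<^sup>2"
  unfolding det_3 inner_vec_def sum_3 by (simp add: power2_eq_square algebra_simps)

lemma solid_volume_simplex:
  fixes p x y z :: "real^3"
  assumes "card {p, x, y, z} = 4"
  shows "solid_volume (convex hull {p, x, y, z}) =
    \<bar>det (\<chi> i j. (if j = 1 then x - p else if j = 2 then y - p else z - p) $ i)\<bar> / 6"
proof -
  have dis: "p \<noteq> x" "p \<noteq> y" "p \<noteq> z" "x \<noteq> y" "x \<noteq> z" "y \<noteq> z"
    using assms by (auto simp: card_insert_if split: if_splits)
  define f :: "3 \<Rightarrow> real^3" where "f = (\<lambda>j. if j = 1 then x else if j = 2 then y else z)"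
  have bij: "bij_betw f UNIV ({p, x, y, z} - {p})"
    unfolding bij_betw_def inj_on_def UNIV_3 using dis by (auto simp: f_def)
  have "solid_volume (convex hull {p, x, y, z}) = measure lborel (convex hull {p, x, y, z})"
    unfolding solid_volume_def
    by (intro measure_completion) (simp add: borel_compact finite_imp_compact_convex_hull)
  also have "\<dots> = \<bar>det (\<chi> i j. f j $ i - p $ i)\<bar> / fact CARD(3)"
    by (rule content_simplex[OF _ _ _ bij]) (use assms in auto)
  also have "(\<chi> i j. f j $ i - p $ i) =
      (\<chi> i j. (if j = 1 then x - p else if j = 2 then y - p else z - p) $ i)"
    by (simp add: f_def vec_eq_iff)
  finally show ?thesis by (simp add: fact_numeral)
qed

text \<open>The determinant of the three edge vectors at \<open>p\<close> is computed through their Gram matrix, whose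
  diagonal entries are \<open>d\<^sup>2\<close> and whose other entries are \<open>d\<^sup>2 - a\<^sup>2 / 2\<close> by the law of cosines.\<close>

lemma solid_volume_equilateral_base:
  fixes p x y z :: "real^3"
  assumes a: "a > 0" and d: "d > 0"
    and xy: "dist x y = a" and yz: "dist y z = a" and xz: "dist x z = a"
    and px: "dist p x = d" and py: "dist p y = d" and pz: "dist p z = d"
  shows "solid_volume (convex hull {p, x, y, z}) = 1 / 3 * (sqrt 3 / 4 * a\<^sup>2) * sqrt (d\<^sup>2 - a\<^sup>2 / 3)"
proof -
  define D where "D = det (\<chi> i j. (if j = 1 then x - p else if j = 2 then y - p else z - p) $ i)"
  have ip: "(x - p) \<bullet> (x - p) = d\<^sup>2" "(y - p) \<bullet> (y - p) = d\<^sup>2" "(z - p) \<bullet> (z - p) = d\<^sup>2"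
    "(y - x) \<bullet> (y - x) = a\<^sup>2" "(z - x) \<bullet> (z - x) = a\<^sup>2" "(z - y) \<bullet> (z - y) = a\<^sup>2"
    using assms by (metis dist_norm dist_commute power2_norm_eq_inner)+
  define X Y Z where "X = x - p" and "Y = y - p" and "Z = z - p"
  have sub: "x - p = X" "y - p = Y" "z - p = Z" "y - x = Y - X" "z - x = Z - X" "z - y = Z - Y"
    by (simp_all add: X_def Y_def Z_def)
  have gram: "X \<bullet> X = d\<^sup>2" "Y \<bullet> Y = d\<^sup>2" "Z \<bullet> Z = d\<^sup>2"
    "X \<bullet> Y = d\<^sup>2 - a\<^sup>2/2" "X \<bullet> Z = d\<^sup>2 - a\<^sup>2/2" "Y \<bullet> Z = d\<^sup>2 - a\<^sup>2/2"
    using ip unfolding sub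
    by (auto simp: inner_diff_left inner_diff_right inner_commute)
  have "D\<^sup>2 = 3 * (a\<^sup>2 / 2)\<^sup>2 * (d\<^sup>2 - a\<^sup>2 / 3)"
    unfolding D_def gram_det_3 sub gram by (simp add: power2_eq_square field_simps)
  then have "\<bar>D\<bar> = sqrt (3 * (a\<^sup>2 / 2)\<^sup>2 * (d\<^sup>2 - a\<^sup>2 / 3))"
    by (metis real_sqrt_abs)
  also have "\<dots> = sqrt 3 * (a\<^sup>2 / 2) * sqrt (d\<^sup>2 - a\<^sup>2 / 3)"
    by (simp only: real_sqrt_mult real_sqrt_abs) simp
  finally have D: "\<bar>D\<bar> = sqrt 3 * (a\<^sup>2 / 2) * sqrt (d\<^sup>2 - a\<^sup>2 / 3)" .
  have "card {p, x, y, z} = 4"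
    using assms by (auto simp: card_insert_if)
  then have "solid_volume (convex hull {p, x, y, z}) = \<bar>D\<bar> / 6"
    unfolding D_def by (rule solid_volume_simplex)
  then show ?thesis by (simp add: D)
qed

section \<open>Equilateral triangles closing up around a vertex\<close>

lemma orthogonal_to_three_eq_0:
  fixes x u v w :: "real^3"
  assumes nz: "u \<noteq> 0" "v \<noteq> 0" "w \<noteq> 0"
    and orth: "u \<bullet> v = 0" "u \<bullet> w = 0" "v \<bullet> w = 0"
    and x: "x \<bullet> u = 0" "x \<bullet> v = 0" "x \<bullet> w = 0"
  shows "x = 0"
proof (rule ccontr)
  assume x0: "x \<noteq> 0"
  have dis: "distinct [x, u, v, w]" using nz orth x x0 by auto
  have "pairwise orthogonal {x, u, v, w}"
    using orth x by (auto simp: pairwise_def orthogonal_def inner_commute)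
  then have "independent {x, u, v, w}"
    using nz x0 by (intro pairwise_orthogonal_independent) auto
  then have "card {x, u, v, w} \<le> DIM(real^3)"
    using independent_bound by blast
  with dis show False by simp
qed

text \<open>The rotation rule around a vertex. If \<open>p\<close> and \<open>q\<close> are the two points of the sphere of radius 2
  that complete the edge \<open>u e\<close> to a triangle with all mutual inner products \<open>k\<close>, then the
  reflection in the linear span of \<open>u\<close> and \<open>e\<close> exchanges \<open>p\<close> and \<open>q\<close>, so their sum lies in that span, and by
  symmetry in \<open>u\<close> and \<open>e\<close> it is a multiple of \<open>u + e\<close>. In particular \<open>q\<close> is determined by \<open>p\<close>:
  no edge can carry three such triangles.\<close>

lemma apexes_over_edge_sum:
  fixes u e p q :: "real^3"
  assumes norms: "u \<bullet> u = 4" "e \<bullet> e = 4" "p \<bullet> p = 4" "q \<bullet> q = 4"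
    and k: "u \<bullet> e = k" "u \<bullet> p = k" "u \<bullet> q = k" "e \<bullet> p = k" "e \<bullet> q = k"
    and k4: "-4 < k" "k < 4" and "p \<noteq> q"
  shows "p + q = (2 * k / (4 + k)) *\<^sub>R (u + e)"
proof -
  define t where "t = 2 * k / (4 + k)"
  have t: "t * (4 + k) = 2 * k" using k4 by (simp add: t_def)
  note ip = norms k inner_commute[of e u] inner_commute[of p u] inner_commute[of q u]
    inner_commute[of p e] inner_commute[of q e] inner_commute[of q p]
  note ex = inner_add_left inner_add_right inner_diff_left inner_diff_right
  have "p + q - t *\<^sub>R (u + e) = 0"
  proof (rule orthogonal_to_three_eq_0[of "u + e" "u - e" "p - q"])
    have "(u + e) \<bullet> (u + e) \<noteq> 0" "(u - e) \<bullet> (u - e) \<noteq> 0"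
      unfolding ex using k4 by (simp_all add: ip)
    then show "u + e \<noteq> 0" "u - e \<noteq> 0" by (metis inner_zero_left)+
    show "p - q \<noteq> 0" using \<open>p \<noteq> q\<close> by simp
    show "(p + q - t *\<^sub>R (u + e)) \<bullet> (u + e) = 0"
      using t unfolding ex by (simp add: ip ex algebra_simps)
  qed (simp_all add: ex ip)
  then show ?thesis by (simp add: t_def)
qed

text \<open>Five triangles closing up around the vertex \<open>u\<close>. Summing the rotation rule over the cycle
  determines \<open>w0 + w1 + w2 + w3 + w4\<close> as a multiple of \<open>u\<close>, and the inner product of this relation
  with \<open>w0\<close> is a cubic equation for \<open>k\<close>, with roots \<open>4\<close> and \<open>\<plusminus>4 / sqrt 5\<close>. The negative root
  is the pentagram, in which the neighbours wind twice around \<open>u\<close> as in the great icosahedron.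
  Convexity excludes it: the plane \<open>n \<bullet> x = b\<close> through the triangle \<open>u w0 w1\<close> would have \<open>w3\<close> on
  the wrong side.\<close>

lemma pentagonal_link_inner:
  fixes u w0 w1 w2 w3 w4 n :: "real^3"
  assumes norms: "u \<bullet> u = 4" "w0 \<bullet> w0 = 4" "w1 \<bullet> w1 = 4" "w2 \<bullet> w2 = 4" "w3 \<bullet> w3 = 4" "w4 \<bullet> w4 = 4"
    and spokes: "u \<bullet> w0 = k" "u \<bullet> w1 = k" "u \<bullet> w2 = k" "u \<bullet> w3 = k" "u \<bullet> w4 = k"
    and rim: "w0 \<bullet> w1 = k" "w1 \<bullet> w2 = k" "w2 \<bullet> w3 = k" "w3 \<bullet> w4 = k" "w4 \<bullet> w0 = k"
    and ne: "w4 \<noteq> w1" "w0 \<noteq> w2" "w1 \<noteq> w3" "w2 \<noteq> w4" "w3 \<noteq> w0"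
    and k4: "-4 < k" "k < 4"
    and plane: "n \<bullet> u = b" "n \<bullet> w0 = b" "n \<bullet> w1 = b"
    and below: "n \<bullet> w2 < b" "n \<bullet> w3 \<le> b"
  shows "k = 4 / sqrt 5"
proof -
  define t where "t = 2 * k / (4 + k)"
  have t: "t * (4 + k) = 2 * k" using k4 by (simp add: t_def)
  note c = inner_commute
  have s0: "w4 + w1 = t *\<^sub>R (u + w0)" unfolding t_def
    by (rule apexes_over_edge_sum) (use assms in \<open>simp_all add: c\<close>)
  have s1: "w0 + w2 = t *\<^sub>R (u + w1)" unfolding t_def
    by (rule apexes_over_edge_sum) (use assms in \<open>simp_all add: c\<close>)
  have s2: "w1 + w3 = t *\<^sub>R (u + w2)" unfolding t_def
    by (rule apexes_over_edge_sum) (use assms in \<open>simp_all add: c\<close>)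
  have s3: "w2 + w4 = t *\<^sub>R (u + w3)" unfolding t_def
    by (rule apexes_over_edge_sum) (use assms in \<open>simp_all add: c\<close>)
  have s4: "w3 + w0 = t *\<^sub>R (u + w4)" unfolding t_def
    by (rule apexes_over_edge_sum) (use assms in \<open>simp_all add: c\<close>)
  define S where "S = w0 + w1 + w2 + w3 + w4"
  have "2 *\<^sub>R S = (w4 + w1) + (w0 + w2) + (w1 + w3) + (w2 + w4) + (w3 + w0)"
    by (simp add: S_def scaleR_2 algebra_simps)
  also have "\<dots> = t *\<^sub>R (5 *\<^sub>R u + S)"
    unfolding s0 s1 s2 s3 s4 by (simp add: S_def vec_eq_iff algebra_simps)
  finally have S2: "2 *\<^sub>R S = t *\<^sub>R (5 *\<^sub>R u + S)" .
  have S: "S \<bullet> x = 5 * k / 4 * (u \<bullet> x)" for x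
  proof -
    have "(2 *\<^sub>R S) \<bullet> x = (t *\<^sub>R (5 *\<^sub>R u + S)) \<bullet> x" using S2 by simp
    then have "2 * (S \<bullet> x) = t * (5 * (u \<bullet> x) + S \<bullet> x)" by (simp add: inner_add_left)
    then have "(4 + k) * (2 * (S \<bullet> x)) = (t * (4 + k)) * (5 * (u \<bullet> x) + S \<bullet> x)" by simp
    then have "8 * (S \<bullet> x) = 10 * k * (u \<bullet> x)" unfolding t by (simp add: algebra_simps)
    then show ?thesis by simp
  qed
  have diag: "w2 \<bullet> w0 = 2 * k * t - 4" "w3 \<bullet> w0 = 2 * k * t - 4"
  proof -
    have "(w0 + w2) \<bullet> w0 = 2 * k * t"
      unfolding s1 using spokes rim by (simp add: inner_add_left inner_add_right c)
    then show "w2 \<bullet> w0 = 2 * k * t - 4" using norms by (simp add: inner_add_left)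
    have "(w3 + w0) \<bullet> w0 = 2 * k * t"
      unfolding s4 using spokes rim by (simp add: inner_add_left inner_add_right c)
    then show "w3 \<bullet> w0 = 2 * k * t - 4" using norms by (simp add: inner_add_left)
  qed
  \<comment> \<open>Two neighbours of \<open>w0\<close> on the rim and two diagonals of the pentagon.\<close>
  have "4 + 2 * k + 2 * (2 * k * t - 4) = 5 * k / 4 * k"
    using S[of w0] spokes rim norms diag
    by (simp add: S_def inner_add_left inner_commute[of w1 w0])
  then have "(4 + k) * (2 * k - 4) + 4 * k * (t * (4 + k)) = 5 * k\<^sup>2 / 4 * (4 + k)"
    by algebra
  then have "(k - 4) * (5 * k\<^sup>2 - 16) = 0"
    unfolding t by (simp add: power2_eq_square algebra_simps)
  \<comment> \<open>\<open>k = 4\<close> is the degenerate case in which all points coincide.\<close>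
  then have k2: "5 * k\<^sup>2 = 16" using k4 by simp
  have n2: "n \<bullet> w2 = 2 * t * b - b" "n \<bullet> w4 = 2 * t * b - b"
    using arg_cong[OF s1, of "\<lambda>x. n \<bullet> x"] arg_cong[OF s0, of "\<lambda>x. n \<bullet> x"] plane
    by (simp_all add: inner_add_right algebra_simps)
  have n3: "n \<bullet> w3 = (5 * k / 4 - 4 * t) * b"
    using S[of n] plane n2 by (simp add: S_def inner_add_left c algebra_simps)
  have t1: "t < 1" using k4 by (simp add: t_def)
  have "(2 * t - 2) * b < 0" using n2 below by (simp add: algebra_simps)
  then have b: "b > 0" using t1 by (simp add: mult_less_0_iff)
  have "(5 * k / 4 - 4 * t) * b \<le> 1 * b" using n3 below by simp
  then have "5 * k / 4 - 4 * t \<le> 1" using b by (meson mult_le_cancel_right_pos)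
  then have "(5 * k / 4 - 4 * t) * (4 + k) \<le> 1 * (4 + k)"
    using k4 by (intro mult_right_mono) auto
  then have "(5 * k / 4) * (4 + k) - 4 * (2 * k) \<le> 4 + k"
    unfolding t[symmetric] by (simp add: algebra_simps)
  then have "0 \<le> k" using k2 by (simp add: algebra_simps power2_eq_square)
  have "(sqrt 5 * k)\<^sup>2 = 4\<^sup>2" using k2 by (simp add: power_mult_distrib)
  then have "sqrt 5 * k = 4" using \<open>0 \<le> k\<close>
    by (metis power2_eq_iff_nonneg mult_nonneg_nonneg real_sqrt_ge_zero zero_le_numeral)
  then show ?thesis by (simp add: field_simps)
qed

text \<open>A simple graph in which every vertex has degree two is a union of cycles of length at least
  three, and five edges are too few for two such cycles. The proof walks along the graph from an
  edge \<open>a b\<close> in both directions; closing up after three or four edges would leave a second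
  component with only two or one edges.\<close>

lemma five_edges_form_pentagon:
  assumes card: "card E = 5" and pair: "\<And>e. e \<in> E \<Longrightarrow> card e = 2"
    and next_edge: "\<And>x y. {x, y} \<in> E \<Longrightarrow>
      \<exists>z. z \<noteq> x \<and> {y, z} \<in> E \<and> (\<forall>u. {y, u} \<in> E \<longrightarrow> u = x \<or> u = z)"
  obtains a b c d e where "distinct [a, b, c, d, e]"
    "{a, b} \<in> E" "{b, c} \<in> E" "{c, d} \<in> E" "{d, e} \<in> E" "{e, a} \<in> E"
proof -
  have fin: "finite E" using card by (metis card.infinite zero_neq_numeral)
  have neq: "x \<noteq> y" if "{x, y} \<in> E" for x y using pair[OF that] by auto
  have remaining: "\<exists>x y. {x, y} \<in> E \<and> {x, y} \<notin> set Ks" if "length Ks < 5" for Ks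
  proof -
    have "card (set Ks) < card E" using that card card_length[of Ks] by linarith
    then have "\<not> E \<subseteq> set Ks" using card_mono[of "set Ks" E] by auto
    then obtain f where "f \<in> E" "f \<notin> set Ks" by blast
    then show ?thesis using pair[of f] by (metis card_2_iff)
  qed
  have too_many: False if "distinct Ks" "length Ks = 6" "set Ks \<subseteq> E" for Ks
    using that card card_mono[OF fin that(3)] distinct_card[OF that(1)] by simp
  obtain a b where ab: "{a, b} \<in> E" using remaining[of "[]"] by auto
  obtain c where c: "c \<noteq> a" "{b, c} \<in> E" "\<And>u. {b, u} \<in> E \<Longrightarrow> u = a \<or> u = c"
    using next_edge[OF ab] by blast
  obtain d where d: "d \<noteq> b" "{c, d} \<in> E" "\<And>u. {c, u} \<in> E \<Longrightarrow> u = b \<or> u = d"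
    using next_edge[OF c(2)] by blast
  obtain e where e: "e \<noteq> b" "{a, e} \<in> E" "\<And>u. {a, u} \<in> E \<Longrightarrow> u = b \<or> u = e"
    using next_edge[of b a] ab by (auto simp: insert_commute)
  have ne: "a \<noteq> b" "b \<noteq> c" "c \<noteq> d" "a \<noteq> e" using neq ab c(2) d(2) e(2) by auto
  have "d \<noteq> a"
  proof
    assume "d = a"
    let ?K = "{{a, b}, {b, c}, {c, a}}"
    obtain x y where xy: "{x, y} \<in> E" "{x, y} \<notin> ?K"
      using remaining[of "[{a, b}, {b, c}, {c, a}]"] by auto
    have "e = c" using e(3)[of c] d(2) ne \<open>d = a\<close> by (auto simp: insert_commute)
    have sat: "u \<in> {a, b, c}" if "{s, u} \<in> E" "s \<in> {a, b, c}" for s u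
      using that c(3)[of u] d(3)[of u] e(3)[of u] \<open>d = a\<close> \<open>e = c\<close> by auto
    have sat2: "{s, u} \<in> ?K" if "{s, u} \<in> E" "s \<in> {a, b, c}" for s u
      using sat[OF that] that(2) neq[OF that(1)] by (auto simp: doubleton_eq_iff)
    have out: "x \<notin> {a, b, c}" "y \<notin> {a, b, c}"
      using sat2[of x y] sat2[of y x] xy unfolding insert_commute[of y x] by blast+
    obtain z where z: "z \<noteq> x" "{y, z} \<in> E" using next_edge[OF xy(1)] by blast
    obtain z' where z': "z' \<noteq> y" "{x, z'} \<in> E" using next_edge[of y x] xy by (auto simp: insert_commute)
    have out': "a \<noteq> x" "b \<noteq> x" "c \<noteq> x" "a \<noteq> y" "b \<noteq> y" "c \<noteq> y" using out by auto
    \<comment> \<open>Besides the triangle, the edge \<open>x y\<close> and the next edges at its two ends make six.\<close>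
    have dist: "distinct [{a, b}, {b, c}, {c, a}, {x, y}, {y, z}, {x, z'}]"
      using ne ne[symmetric] c(1) out' out'[symmetric] z(1) z'(1)[symmetric] neq[OF xy(1)]
      by (simp add: doubleton_eq_iff)
    have sub: "set [{a, b}, {b, c}, {c, a}, {x, y}, {y, z}, {x, z'}] \<subseteq> E"
      using ab c d \<open>d = a\<close> xy z z' by auto
    show False using too_many[OF dist _ sub] by simp
  qed
  have "e \<noteq> c" using d(3)[of a] e(2) ne \<open>d \<noteq> a\<close> by (auto simp: insert_commute)
  have "d \<noteq> e"
  proof
    assume "d = e"
    let ?K = "{{a, b}, {b, c}, {c, d}, {a, d}}"
    have d4: "u = a \<or> u = c" if "{d, u} \<in> E" for u
      using next_edge[OF d(2)] that e(2) \<open>d = e\<close> c(1) by (metis insert_commute)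
    obtain x y where xy: "{x, y} \<in> E" "{x, y} \<notin> ?K"
      using remaining[of "[{a, b}, {b, c}, {c, d}, {a, d}]"] by (simp only: list.set list.size) auto
    have sat2: "{s, u} \<in> ?K" if "{s, u} \<in> E" "s \<in> {a, b, c, d}" for s u
      using that c(3)[of u] d(3)[of u] e(3)[of u] d4[of u] \<open>d = e\<close> by (auto simp: doubleton_eq_iff)
    have out: "x \<notin> {a, b, c, d}" "y \<notin> {a, b, c, d}"
      using sat2[of x y] sat2[of y x] xy unfolding insert_commute[of y x] by blast+
    obtain z where z: "z \<noteq> x" "{y, z} \<in> E" using next_edge[OF xy(1)] by blast
    have out': "a \<noteq> x" "b \<noteq> x" "c \<noteq> x" "d \<noteq> x" "a \<noteq> y" "b \<noteq> y" "c \<noteq> y" "d \<noteq> y"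
      using out by auto
    have dist: "distinct [{a, b}, {b, c}, {c, d}, {a, d}, {x, y}, {y, z}]"
      using ne ne[symmetric] c(1) d(1) \<open>d \<noteq> a\<close> out' out'[symmetric] z(1) neq[OF xy(1)]
      by (simp add: doubleton_eq_iff)
    have sub: "set [{a, b}, {b, c}, {c, d}, {a, d}, {x, y}, {y, z}] \<subseteq> E"
      using ab c d e \<open>d = e\<close> xy z by auto
    show False using too_many[OF dist _ sub] by simp
  qed
  obtain z where z: "z \<noteq> c" "{d, z} \<in> E" using next_edge[OF d(2)] by blast
  obtain y where y: "y \<noteq> a" "{e, y} \<in> E" using next_edge[OF e(2)] by blast
  have "z = e"
  proof (rule ccontr)
    assume "z \<noteq> e"
    then have dist: "distinct [{a, b}, {b, c}, {c, d}, {a, e}, {d, z}, {e, y}]"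
      using ne c(1) d(1) e(1) \<open>d \<noteq> a\<close> \<open>e \<noteq> c\<close> \<open>d \<noteq> e\<close> z(1) y(1)
      by (auto simp: doubleton_eq_iff)
    have sub: "set [{a, b}, {b, c}, {c, d}, {a, e}, {d, z}, {e, y}] \<subseteq> E"
      using ab c d e z y by auto
    show False using too_many[OF dist _ sub] by simp
  qed
  show thesis
    by (rule that[of a b c d e])
       (use ne c d e ab z \<open>z = e\<close> \<open>d \<noteq> a\<close> \<open>e \<noteq> c\<close> \<open>d \<noteq> e\<close> in \<open>auto simp: insert_commute\<close>)
qed

section \<open>The edge length of the icosahedron\<close>

lemma unit_spheres_touch_imp_dist: "dist x y = 2" if touch: "unit_spheres_touch x y"
proof (rule antisym)
  obtain z where "dist x z = 1" "dist y z = 1"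
    using touch by (auto simp: unit_spheres_touch_def)
  then show "dist x y \<le> 2" using dist_triangle[of x y z] by (simp add: dist_commute)
  show "2 \<le> dist x y"
  proof (rule ccontr)
    assume "\<not> 2 \<le> dist x y"
    then have "midpoint x y \<in> ball x 1 \<inter> ball y 1"
      by (simp add: dist_midpoint)
    with touch show False by (auto simp: unit_spheres_touch_def)
  qed
qed

lemma equilateral_triangle_vertices:
  assumes "equilateral_triangle a F"
  defines "C \<equiv> {x. x extreme_point_of F}"
  shows "\<not> affine_dependent C" "card C = 3" "F = convex hull C"
    "\<And>x y. x \<in> C \<Longrightarrow> y \<in> C \<Longrightarrow> x \<noteq> y \<Longrightarrow> dist x y = a"
proof -
  obtain D where D: "\<not> affine_dependent D" "int (card D) = 2 + 1" "F = convex hull D"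
    "\<forall>x\<in>D. \<forall>y\<in>D. x \<noteq> y \<longrightarrow> dist x y = a"
    using assms(1) unfolding equilateral_triangle_def regular_simplex_def by blast
  have "C = D" unfolding C_def D(3)
    using extreme_point_of_convex_hull_affine_independent[OF D(1)] by blast
  with D show "\<not> affine_dependent C" "card C = 3" "F = convex hull C"
    "\<And>x y. x \<in> C \<Longrightarrow> y \<in> C \<Longrightarrow> x \<noteq> y \<Longrightarrow> dist x y = a" by auto
qed

text \<open>Each nonempty proper face of a polyhedron is the intersection of the facets containing it, so
  one facet alone cannot cut out the edge \<open>x y\<close>.\<close>

lemma edge_in_further_facet:
  fixes P :: "(real^3) set"
  assumes P: "polyhedron P" and F: "F facet_of P" and C: "\<not> affine_dependent {x, y, z}"
    and z: "z \<notin> {x, y}" and hull: "F = convex hull {x, y, z}"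
  obtains G where "G facet_of P" "x \<in> G" "y \<in> G" "z \<notin> G"
proof -
  define e where "e = convex hull {x, y}"
  have zF: "z \<in> F" unfolding hull by (simp add: hull_inc)
  have ze: "z \<notin> e"
  proof
    assume "z \<in> e"
    then have "convex hull (insert z {x, y}) = e"
      unfolding e_def by (rule hull_redundant)
    then have "F = e" unfolding hull by (simp add: insert_commute)
    moreover have "z extreme_point_of F"
      unfolding hull using C by (simp add: extreme_point_of_convex_hull_affine_independent)
    ultimately show False using z extreme_point_of_convex_hull[of z "{x, y}"] by (simp add: e_def)
  qed
  have "e face_of F"
    unfolding hull face_of_convex_hull_affine_independent[OF C] e_def
    by (intro exI[of _ "{x, y}"]) auto
  then have face: "e face_of P" using facet_of_imp_face_of[OF F] by (rule face_of_trans)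
  have "e \<noteq> {}" by (simp add: e_def)
  moreover have "e \<noteq> P" using zF ze facet_of_imp_subset[OF F] by blast
  ultimately have "e = \<Inter>{G. G facet_of P \<and> e \<subseteq> G}"
    using face_of_polyhedron[OF P face] by blast
  with ze obtain G where "G facet_of P" "e \<subseteq> G" "z \<notin> G" by blast
  moreover have "x \<in> e" "y \<in> e" by (auto simp: e_def hull_inc)
  ultimately show thesis using that by blast
qed

text \<open>Put the origin at \<open>c\<close>. Adjacent vertices have inner product \<open>k = 4 - a\<^sup>2 / 2\<close>. The five facets at
  a vertex \<open>v\<close> give five edges in the link of \<open>v\<close>. Each neighbour of \<open>v\<close> lies on at least two of
  them because every edge of \<open>P\<close> lies in two facets, and on at most two because the vertices lie on a
  sphere and only two points of it complete an edge to a triangle of the given size. Hence the link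
  is a pentagon and \<open>k\<close> is known.\<close>

lemma icosahedron_edge_length:
  assumes conf: "icosahedral_configuration c P" and F: "F facet_of P"
  obtains a where "a > 0" "a\<^sup>2 = 8 - 8 / sqrt 5" "equilateral_triangle a F"
proof -
  define V where "V G = {x. x extreme_point_of G}" for G :: "(real^3) set"
  have P: "polytope P" "polyhedron P"
    using conf by (auto simp: icosahedral_configuration_def regular_icosahedron_def polytope_imp_polyhedron)
  obtain a where "\<And>G. G facet_of P \<Longrightarrow> equilateral_triangle a G"
    using conf unfolding icosahedral_configuration_def regular_icosahedron_def by blast
  note tri = equilateral_triangle_vertices[OF this, folded V_def]
  have VP: "x extreme_point_of P" if "x \<in> V G" "G facet_of P" for x G
    using that extreme_point_of_face[OF facet_of_imp_face_of] by (auto simp: V_def)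
  have VI: "x \<in> V G" if "x extreme_point_of P" "x \<in> G" "G facet_of P" for x G
    using that extreme_point_of_face[OF facet_of_imp_face_of] by (auto simp: V_def)
  have VG: "x \<in> G" if "x \<in> V G" for x G
    using that by (auto simp: V_def extreme_point_of_def)
  have five: "card {G. G facet_of P \<and> x \<in> G} = 5" if "x extreme_point_of P" for x
    using conf that by (auto simp: icosahedral_configuration_def regular_icosahedron_def)
  have radius: "(x - c) \<bullet> (x - c) = 4" if "x extreme_point_of P" for x
  proof -
    have "dist c x = 2"
      using conf that by (auto simp: icosahedral_configuration_def unit_spheres_touch_imp_dist)
    then have "(norm (x - c))\<^sup>2 = 2\<^sup>2" by (simp add: dist_norm norm_minus_commute)
    then show ?thesis by (simp add: power2_norm_eq_inner)
  qed
  define k where "k = 4 - a\<^sup>2 / 2"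
  have inner: "(x - c) \<bullet> (y - c) = k" if "x \<in> V G" "y \<in> V G" "x \<noteq> y" "G facet_of P" for x y G
  proof -
    have "((x - c) - (y - c)) \<bullet> ((x - c) - (y - c)) = a\<^sup>2"
      using tri(4)[OF that(4,1,2,3)] by (simp add: dist_norm flip: power2_norm_eq_inner)
    then show ?thesis
      using radius[OF VP[OF that(1,4)]] radius[OF VP[OF that(2,4)]]
      unfolding inner_diff_left[of "x - c" "y - c"] inner_diff_right[of _ "x - c" "y - c"]
      by (simp add: k_def inner_commute[of "y - c" "x - c"])
  qed
  obtain v x0 y0 where vF: "V F = {v, x0, y0}" "v \<noteq> x0" "v \<noteq> y0" "x0 \<noteq> y0"
    using tri(2)[OF F] by (metis card_3_iff)
  have v: "v extreme_point_of P" using vF VP[OF _ F] by simp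
  have "a > 0"
    using tri(4)[OF F, of v x0] vF by (metis insertI1 insertI2 zero_less_dist_iff)
  then have k4: "k < 4" by (simp add: k_def)
  \<comment> \<open>The vectors to three vertices of one facet have a sum of nonnegative square norm \<open>12 + 6 * k\<close>.\<close>
  have k4': "-4 < k"
  proof -
    have "0 \<le> ((v - c) + (x0 - c) + (y0 - c)) \<bullet> ((v - c) + (x0 - c) + (y0 - c))"
      by (rule inner_ge_zero)
    also have "\<dots> = 12 + 6 * k"
      using inner[of v F x0] inner[of v F y0] inner[of x0 F y0] inner[of x0 F v] inner[of y0 F v] inner[of y0 F x0]
        radius[OF VP[OF _ F, of v]] radius[OF VP[OF _ F, of x0]] radius[OF VP[OF _ F, of y0]] vF F
      unfolding inner_add_left[of "_ - c"] inner_add_right[of _ "_ - c"] inner_add_left[of "_ + _" "y0 - c"]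
         inner_add_right[of _ "_ + _" "y0 - c"]
      by simp
    finally show ?thesis by simp
  qed

  \<comment> \<open>The link of \<open>v\<close>: for each facet at \<open>v\<close>, its edge opposite to \<open>v\<close>.\<close>
  define E where "E = (\<lambda>G. V G - {v}) ` {G. G facet_of P \<and> v \<in> G}"
  have inE: "{x, y} \<in> E \<longleftrightarrow> x \<noteq> y \<and> x \<noteq> v \<and> y \<noteq> v \<and> (\<exists>G. G facet_of P \<and> V G = {v, x, y})" for x y
  proof
    assume "{x, y} \<in> E"
    then obtain G where G: "G facet_of P" "v \<in> G" "{x, y} = V G - {v}" by (auto simp: E_def)
    then have "V G = {v, x, y}" using VI[OF v G(2,1)] by blast
    moreover have "v \<noteq> x" "v \<noteq> y" using G(3) by blast+
    moreover have "x \<noteq> y" using tri(2)[OF G(1)] calculation by (auto simp: card_insert_if)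
    ultimately show "x \<noteq> y \<and> x \<noteq> v \<and> y \<noteq> v \<and> (\<exists>G. G facet_of P \<and> V G = {v, x, y})"
      using G(1) by blast
  next
    assume "x \<noteq> y \<and> x \<noteq> v \<and> y \<noteq> v \<and> (\<exists>G. G facet_of P \<and> V G = {v, x, y})"
    then obtain G where G: "G facet_of P" "V G = {v, x, y}" "x \<noteq> v" "y \<noteq> v" by blast
    then have "{x, y} = V G - {v}" "v \<in> G" using VG[of v G] by auto
    with G(1) show "{x, y} \<in> E" unfolding E_def by blast
  qed
  have "inj_on (\<lambda>G. V G - {v}) {G. G facet_of P \<and> v \<in> G}"
  proof (rule inj_onI)
    fix G H assume G: "G \<in> {G. G facet_of P \<and> v \<in> G}" and H: "H \<in> {G. G facet_of P \<and> v \<in> G}"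
      and eq: "V G - {v} = V H - {v}"
    have "v \<in> V G" "v \<in> V H" using G H v VI by auto
    then have "V G = V H" using eq by blast
    then show "G = H" using tri(3)[of G] tri(3)[of H] G H by simp
  qed
  then have cardE: "card E = 5" unfolding E_def using five[OF v] by (simp add: card_image)
  have pairE: "card e = 2" if e: "e \<in> E" for e
  proof -
    obtain G where G: "G facet_of P" "v \<in> G" "e = V G - {v}" using e by (auto simp: E_def)
    then show ?thesis using tri(2)[OF G(1)] VI[OF v G(2,1)] by (simp add: card_Diff_singleton)
  qed
  have next_edge: "\<exists>z. z \<noteq> x \<and> {y, z} \<in> E \<and> (\<forall>u. {y, u} \<in> E \<longrightarrow> u = x \<or> u = z)"
    if xy: "{x, y} \<in> E" for x y
  proof -
    obtain G where G: "G facet_of P" "V G = {v, x, y}" and ne: "x \<noteq> y" "x \<noteq> v" "y \<noteq> v"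
      using xy inE by blast
    have VG3: "V G = {v, y, x}" using G(2) by blast
    have "\<not> affine_dependent {v, y, x}" "G = convex hull {v, y, x}"
      using tri(1,3)[OF G(1)] VG3 by auto
    then obtain H where H: "H facet_of P" "v \<in> H" "y \<in> H" "x \<notin> H"
      using edge_in_further_facet[OF P(2) G(1)] ne by (metis insertE singletonD)
    have y: "y extreme_point_of P" using VP[OF _ G(1)] G(2) by simp
    have vy: "v \<in> V H" "y \<in> V H" using VI v y H by auto
    have "card (V H - {v, y}) = 1"
      using tri(2)[OF H(1)] vy ne by (simp add: card_Diff_subset)
    then obtain z where "V H - {v, y} = {z}" by (metis card_1_singletonE)
    then have VH: "V H = {v, y, z}" and z: "z \<noteq> v" "z \<noteq> y" using vy by blast+
    have zx: "z \<noteq> x" using H(4) VG[of z H] VH by auto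
    have yz: "{y, z} \<in> E" using inE z ne VH H(1) by blast
    have sum: "(p - c) + (q - c) = (2 * k / (4 + k)) *\<^sub>R ((v - c) + (y - c))"
      if pq: "{y, p} \<in> E" "{y, q} \<in> E" "p \<noteq> q" for p q
    proof -
      obtain Gp where Gp: "Gp facet_of P" "V Gp = {v, y, p}" "p \<noteq> v" "y \<noteq> p" using pq inE by blast
      obtain Gq where Gq: "Gq facet_of P" "V Gq = {v, y, q}" "q \<noteq> v" "y \<noteq> q" using pq inE by blast
      show ?thesis
        by (rule apexes_over_edge_sum)
          (use Gp Gq ne k4 k4' pq(3) in
            \<open>auto intro: radius VP[OF _ Gp(1)] VP[OF _ Gq(1)] inner[OF _ _ _ Gp(1)] inner[OF _ _ _ Gq(1)]\<close>)
    qed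
    have "u = x \<or> u = z" if "{y, u} \<in> E" for u
    proof (rule ccontr)
      assume nu: "\<not> (u = x \<or> u = z)"
      have yx: "{y, x} \<in> E" using xy by (simp add: insert_commute)
      have "x \<noteq> u" "x \<noteq> z" using nu zx by auto
      then have "(x - c) + (u - c) = (x - c) + (z - c)"
        unfolding sum[OF yx that \<open>x \<noteq> u\<close>] sum[OF yx yz \<open>x \<noteq> z\<close>] by simp
      then show False using nu by simp
    qed
    then show ?thesis using zx yz by blast
  qed
  obtain w0 w1 w2 w3 w4 where dis: "distinct [w0, w1, w2, w3, w4]"
    and edges: "{w0, w1} \<in> E" "{w1, w2} \<in> E" "{w2, w3} \<in> E" "{w3, w4} \<in> E" "{w4, w0} \<in> E"
    using five_edges_form_pentagon[OF cardE pairE next_edge] by metis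
  have edgeE: "x extreme_point_of P" "y extreme_point_of P"
    "(v - c) \<bullet> (x - c) = k" "(v - c) \<bullet> (y - c) = k" "(x - c) \<bullet> (y - c) = k"
    if xy: "{x, y} \<in> E" for x y
  proof -
    obtain G where G: "G facet_of P" "V G = {v, x, y}" and ne: "x \<noteq> y" "x \<noteq> v" "y \<noteq> v"
      using xy inE by blast
    show "x extreme_point_of P" "y extreme_point_of P" using VP[OF _ G(1)] G(2) by auto
    show "(v - c) \<bullet> (x - c) = k" "(v - c) \<bullet> (y - c) = k" "(x - c) \<bullet> (y - c) = k"
      using ne G by (auto intro!: inner[OF _ _ _ G(1)])
  qed
  obtain G where G: "G facet_of P" "V G = {v, w0, w1}" and wv: "w0 \<noteq> v" "w1 \<noteq> v"
    using edges(1) inE by blast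
  obtain n b where nb: "P \<subseteq> {x. n \<bullet> x \<le> b}" "G = P \<inter> {x. n \<bullet> x = b}"
    using facet_of_polyhedron[OF P(2) G(1)] by metis
  have w2v: "w2 \<noteq> v" using edges(2) inE by blast
  have inP: "x \<in> P" if "x extreme_point_of P" for x using that by (simp add: extreme_point_of_def)
  have on: "n \<bullet> v = b" "n \<bullet> w0 = b" "n \<bullet> w1 = b" using VG[of _ G] G(2) nb(2) by auto
  have "w2 \<notin> G" using VI[OF edgeE(2)[OF edges(2)] _ G(1)] G(2) dis w2v by auto
  then have w2: "n \<bullet> w2 < b" using inP[OF edgeE(2)[OF edges(2)]] nb by force
  have w3: "n \<bullet> w3 \<le> b" using inP[OF edgeE(2)[OF edges(3)]] nb by blast
  have "k = 4 / sqrt 5"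
    by (rule pentagonal_link_inner[of "v - c" "w0 - c" "w1 - c" "w2 - c" "w3 - c" "w4 - c" k n "b - n \<bullet> c"])
      (use edges edgeE radius v dis k4 k4' on w2 w3 in \<open>auto simp: inner_diff_right\<close>)
  then have "a\<^sup>2 = 8 - 8 / sqrt 5" by (simp add: k_def)
  moreover have "equilateral_triangle a F"
    using \<open>\<And>G. G facet_of P \<Longrightarrow> equilateral_triangle a G\<close> F .
  ultimately show thesis using that \<open>a > 0\<close> by blast
qed

section \<open>Exact values\<close>

lemma regular_tetrahedron_measures:
  assumes T: "regular_tetrahedron 2 T" and F: "F facet_of T"
    and p: "p extreme_point_of T" "p \<notin> F"
  shows "planar_area F = sqrt 3" "height_above p F = 2 / 3 * sqrt 6"
    "solid_volume T = 2 / 3 * sqrt 2"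
proof -
  obtain C where C: "\<not> affine_dependent C" "card C = 4" "T = convex hull C"
    and dist: "\<And>x y. x \<in> C \<Longrightarrow> y \<in> C \<Longrightarrow> x \<noteq> y \<Longrightarrow> dist x y = 2"
    using T unfolding regular_tetrahedron_def regular_simplex_def by force
  have pC: "p \<in> C" using p(1) C by (simp add: extreme_point_of_convex_hull_affine_independent)
  obtain u where "u \<in> C" "F = convex hull (C - {u})"
    using F C facet_of_convex_hull_affine_independent_alt by blast
  moreover from this have "u = p" using pC p(2) hull_inc[of p "C - {u}" convex] by auto
  ultimately have F: "F = convex hull (C - {p})" by simp
  have "card (C - {p}) = 3" using C pC by simp
  then obtain x y z where xyz: "C - {p} = {x, y, z}" "x \<noteq> y" "y \<noteq> z" "x \<noteq> z"
    by (metis card_3_iff)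
  have Cp: "C = {p, x, y, z}" using xyz pC by blast
  have ne: "p \<noteq> x" "p \<noteq> y" "p \<noteq> z" using xyz(1) by blast+
  have d: "dist x y = 2" "dist y z = 2" "dist x z = 2" "dist p x = 2" "dist p y = 2" "dist p z = 2"
    using ne xyz(2-4) by (auto intro!: dist simp: Cp)
  have Fx: "F = convex hull {x, y, z}" using F xyz by simp
  show "planar_area F = sqrt 3"
    unfolding Fx using planar_area_equilateral[OF _ d(1-3)] by simp
  have "sqrt (2\<^sup>2 - 2\<^sup>2 / 3) = sqrt ((2 / 3)\<^sup>2 * 6)" by (simp add: power2_eq_square)
  also have "\<dots> = 2 / 3 * sqrt 6" by (simp add: real_sqrt_mult)
  finally have h: "sqrt (2\<^sup>2 - 2\<^sup>2 / 3) = 2 / 3 * sqrt 6" .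
  then show "height_above p F = 2 / 3 * sqrt 6"
    unfolding Fx using height_above_equilateral[OF d] by simp
  have "sqrt 3 * sqrt 6 = 3 * sqrt 2"
  proof -
    have "sqrt 3 * sqrt 6 = sqrt (3\<^sup>2 * 2)" by (simp flip: real_sqrt_mult)
    then show ?thesis by (simp only: real_sqrt_mult real_sqrt_abs)
  qed
  then show "solid_volume T = 2 / 3 * sqrt 2"
    unfolding C(3) Cp using solid_volume_equilateral_base[OF _ _ d] unfolding h by simp
qed

lemma icosahedral_edge_eq:
  assumes "a > 0" "a\<^sup>2 = 8 - 8 / sqrt 5"
  shows "a = 8 / sqrt (10 + 2 * sqrt 5)"
proof -
  have "(8 / sqrt (10 + 2 * sqrt 5))\<^sup>2 = 64 / (10 + 2 * sqrt 5)" by (simp add: power_divide)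
  also have "\<dots> = 8 - 8 / sqrt 5"
  proof -
    have "10 + 2 * sqrt 5 \<noteq> 0" using real_sqrt_ge_zero[of 5] by linarith
    then show ?thesis by (simp add: field_simps)
  qed
  finally show ?thesis using assms
    by (metis power2_eq_iff_nonneg less_imp_le divide_nonneg_nonneg real_sqrt_ge_zero add_nonneg_nonneg
        mult_nonneg_nonneg zero_le_numeral)
qed

lemma icosahedral_height_eq:
  "sqrt (2\<^sup>2 - (8 / sqrt (10 + 2 * sqrt 5))\<^sup>2 / 3) = 2 * sqrt 3 * (3 + sqrt 5) / (3 * sqrt (10 + 2 * sqrt 5))"
proof (rule real_sqrt_unique)
  have pos: "10 + 2 * sqrt 5 \<noteq> 0" using real_sqrt_ge_zero[of 5] by linarith
  have "(2 * sqrt 3 * (3 + sqrt 5) / (3 * sqrt (10 + 2 * sqrt 5)))\<^sup>2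
      = 4 * 3 * (3 + sqrt 5)\<^sup>2 / (9 * (10 + 2 * sqrt 5))"
    by (simp add: power_divide power_mult_distrib)
  also have "\<dots> = 2\<^sup>2 - 64 / (10 + 2 * sqrt 5) / 3"
    using pos by (simp add: field_simps power2_eq_square)
  also have "\<dots> = 2\<^sup>2 - (8 / sqrt (10 + 2 * sqrt 5))\<^sup>2 / 3" by (simp add: power_divide)
  finally show "(2 * sqrt 3 * (3 + sqrt 5) / (3 * sqrt (10 + 2 * sqrt 5)))\<^sup>2
      = 2\<^sup>2 - (8 / sqrt (10 + 2 * sqrt 5))\<^sup>2 / 3" .
qed simp

lemma icosahedral_tetrahedron_measures:
  assumes "icosahedral_tetrahedron c F T"
  defines "a \<equiv> 8 / sqrt (10 + 2 * sqrt 5)"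
  shows "equilateral_triangle a F" "planar_area F = sqrt 3 / 4 * a\<^sup>2"
    "height_above c F = sqrt (2\<^sup>2 - a\<^sup>2 / 3)"
    "solid_volume T = 1 / 3 * (sqrt 3 / 4 * a\<^sup>2) * sqrt (2\<^sup>2 - a\<^sup>2 / 3)"
proof -
  obtain P where P: "icosahedral_configuration c P" "F facet_of P"
    and T: "T = convex hull (insert c {v. v extreme_point_of F})"
    using assms unfolding icosahedral_tetrahedron_def by blast
  obtain a' where a': "a' > 0" "a'\<^sup>2 = 8 - 8 / sqrt 5" "equilateral_triangle a' F"
    using icosahedron_edge_length[OF P] by blast
  have "a' = a" unfolding a_def by (rule icosahedral_edge_eq[OF a'(1,2)])
  with a' have a: "a > 0" and tri: "equilateral_triangle a F" by auto
  show "equilateral_triangle a F" by (rule tri)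
  note V = equilateral_triangle_vertices[OF tri]
  obtain x y z where xyz: "{v. v extreme_point_of F} = {x, y, z}" "x \<noteq> y" "y \<noteq> z" "x \<noteq> z"
    using V(2) by (metis card_3_iff)
  have sides: "dist x y = a" "dist y z = a" "dist x z = a"
    using V(4) xyz by auto
  have "dist c v = 2" if "v \<in> {x, y, z}" for v
  proof -
    have "v extreme_point_of F" using that xyz(1) by blast
    then have "v extreme_point_of P"
      using P(2) extreme_point_of_face facet_of_imp_face_of by blast
    then show ?thesis
      using P(1) by (simp add: icosahedral_configuration_def unit_spheres_touch_imp_dist)
  qed
  then have rad: "dist c x = 2" "dist c y = 2" "dist c z = 2" by auto
  have F: "F = convex hull {x, y, z}" using V(3) xyz(1) by simp
  show "planar_area F = sqrt 3 / 4 * a\<^sup>2"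
    unfolding F by (rule planar_area_equilateral[OF a sides])
  show "height_above c F = sqrt (2\<^sup>2 - a\<^sup>2 / 3)"
    unfolding F by (rule height_above_equilateral[OF sides rad])
  show "solid_volume T = 1 / 3 * (sqrt 3 / 4 * a\<^sup>2) * sqrt (2\<^sup>2 - a\<^sup>2 / 3)"
    unfolding T xyz(1) by (rule solid_volume_equilateral_base[OF a _ sides rad]) simp
qed

section \<open>Decimal values\<close>

lemma rounds_to_intro:
  assumes "10 ^ d * y = of_int m" "of_int m - 1/2 < 10 ^ d * x" "10 ^ d * x < of_int m + 1/2"
  shows "rounds_to d x y"
proof -
  have "round (10 ^ d * x) = m" by (rule round_unique) (use assms in auto)
  then show ?thesis using assms(1) by (simp add: rounds_to_def)
qed

lemma rounds_to_by_square:
  assumes "10 ^ d * y = of_int m" "0 \<le> x"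
    and "0 \<le> lo" "lo\<^sup>2 < x\<^sup>2" "x\<^sup>2 < hi\<^sup>2" "0 \<le> hi"
    and "of_int m - 1/2 \<le> 10 ^ d * lo" "10 ^ d * hi \<le> of_int m + 1/2"
  shows "rounds_to d x y"
proof (rule rounds_to_intro[OF assms(1)])
  have "lo < x" "x < hi" using assms power2_less_imp_less by blast+
  then have "10 ^ d * lo < 10 ^ d * x" "10 ^ d * x < 10 ^ d * hi" by simp_all
  then show "of_int m - 1/2 < 10 ^ d * x" "10 ^ d * x < of_int m + 1/2"
    using assms by linarith+
qed

lemma sqrt_5_bounds: "2.2360679 < sqrt 5" "sqrt 5 < 2.236068"
  by (rule real_less_rsqrt, simp add: power2_eq_square)
     (rule real_less_lsqrt, simp_all add: power2_eq_square)

lemma icosahedral_edge_sq_bounds: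
  "4.42229 < (8 / sqrt (10 + 2 * sqrt 5))\<^sup>2" "(8 / sqrt (10 + 2 * sqrt 5))\<^sup>2 < 4.422292"
proof -
  have "(8 / sqrt (10 + 2 * sqrt 5))\<^sup>2 = 64 / (10 + 2 * sqrt 5)" by (simp add: power_divide)
  moreover have "4.42229 < 64 / (10 + 2 * sqrt 5)" "64 / (10 + 2 * sqrt 5) < 4.422292"
    using sqrt_5_bounds by (simp_all add: field_simps)
  ultimately show "4.42229 < (8 / sqrt (10 + 2 * sqrt 5))\<^sup>2"
    "(8 / sqrt (10 + 2 * sqrt 5))\<^sup>2 < 4.422292" by simp_all
qed

lemma icosahedral_tetrahedron_roundings:
  defines "a \<equiv> 8 / sqrt (10 + 2 * sqrt 5)"
  shows "rounds_to 4 a 2.1029" "rounds_to 5 (sqrt 3 / 4 * a\<^sup>2) 1.91491"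
    "rounds_to 5 (sqrt (2\<^sup>2 - a\<^sup>2 / 3)) 1.58931"
    "rounds_to 5 (1 / 3 * (sqrt 3 / 4 * a\<^sup>2) * sqrt (2\<^sup>2 - a\<^sup>2 / 3)) 1.01446"
proof -
  have a: "4.42229 < a\<^sup>2" "a\<^sup>2 < 4.422292" "a \<ge> 0"
    unfolding a_def using icosahedral_edge_sq_bounds by simp_all
  show "rounds_to 4 a 2.1029"
    by (rule rounds_to_by_square[where m = 21029 and lo = "2.10285" and hi = "2.10295"])
       (use a in \<open>simp_all add: power2_eq_square\<close>)
  have s3: "1.73205 < sqrt 3" "sqrt 3 < 1.732051"
    by (rule real_less_rsqrt, simp add: power2_eq_square)
       (rule real_less_lsqrt, simp_all add: power2_eq_square)
  have "1.73205 * 4.42229 < sqrt 3 * a\<^sup>2" "sqrt 3 * a\<^sup>2 < 1.732051 * 4.422292"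
    using s3 a by (intro mult_strict_mono; simp)+
  then have A: "1.914905 < sqrt 3 / 4 * a\<^sup>2" "sqrt 3 / 4 * a\<^sup>2 < 1.914911" by simp_all
  then show "rounds_to 5 (sqrt 3 / 4 * a\<^sup>2) 1.91491"
    by (intro rounds_to_intro[where m = 191491]) simp_all
  \<comment> \<open>Tighter than the rounding of the height requires, so as to serve for the volume too.\<close>
  have h: "1.589308 < sqrt (2\<^sup>2 - a\<^sup>2 / 3)" "sqrt (2\<^sup>2 - a\<^sup>2 / 3) < 1.58931"
    by (rule real_less_rsqrt, use a in \<open>simp add: power2_eq_square\<close>)
       (rule real_less_lsqrt, use a in \<open>simp_all add: power2_eq_square\<close>)
  then show "rounds_to 5 (sqrt (2\<^sup>2 - a\<^sup>2 / 3)) 1.58931"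
    by (intro rounds_to_intro[where m = 158931]) simp_all
  have "1.914905 * 1.589308 < (sqrt 3 / 4 * a\<^sup>2) * sqrt (2\<^sup>2 - a\<^sup>2 / 3)"
    "(sqrt 3 / 4 * a\<^sup>2) * sqrt (2\<^sup>2 - a\<^sup>2 / 3) < 1.914911 * 1.58931"
    using A h by (intro mult_strict_mono; linarith)+
  then show "rounds_to 5 (1 / 3 * (sqrt 3 / 4 * a\<^sup>2) * sqrt (2\<^sup>2 - a\<^sup>2 / 3)) 1.01446"
    by (intro rounds_to_intro[where m = 101446]) simp_all
qed

lemma regular_tetrahedron_roundings:
  "rounds_to 5 (sqrt 3) 1.73205" "rounds_to 5 (2 / 3 * sqrt 6) 1.63299"
  "rounds_to 5 (2 / 3 * sqrt 2) 0.94281"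
proof -
  show "rounds_to 5 (sqrt 3) 1.73205"
    by (rule rounds_to_by_square[where m = 173205 and lo = "1.732045" and hi = "1.732055"])
       (simp_all add: power2_eq_square)
  show "rounds_to 5 (2 / 3 * sqrt 6) 1.63299"
    by (rule rounds_to_by_square[where m = 163299 and lo = "1.632985" and hi = "1.632995"])
       (simp_all add: power_mult_distrib power2_eq_square[of "_ :: real"])
  show "rounds_to 5 (2 / 3 * sqrt 2) 0.94281"
    by (rule rounds_to_by_square[where m = 94281 and lo = "0.942805" and hi = "0.942815"])
       (simp_all add: power_mult_distrib power2_eq_square[of "_ :: real"])
qed

section \<open>The two tetrahedra\<close>

theorem mainTheorem1:
  shows "(\<forall>T F p. regular_tetrahedron 2 T \<and> F facet_of T \<and> p extreme_point_of T \<and> p \<notin> F \<longrightarrow>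
            planar_area F = sqrt 3 \<and> rounds_to 5 (planar_area F) 1.73205 \<and>
            height_above p F = 2 / 3 * sqrt 6 \<and> rounds_to 5 (height_above p F) 1.63299 \<and>
            solid_volume T = 2 / 3 * sqrt 2 \<and> rounds_to 5 (solid_volume T) 0.94281)
       \<and> (\<forall>c F T. icosahedral_tetrahedron c F T \<longrightarrow>
            equilateral_triangle (8 / sqrt (10 + 2 * sqrt 5)) F \<and>
            rounds_to 4 (8 / sqrt (10 + 2 * sqrt 5)) 2.1029 \<and>
            planar_area F = sqrt 3 / 4 * (8 / sqrt (10 + 2 * sqrt 5))\<^sup>2 \<and>
            rounds_to 5 (planar_area F) 1.91491 \<and>
            height_above c F = 2 * sqrt 3 * (3 + sqrt 5) / (3 * sqrt (10 + 2 * sqrt 5)) \<and>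
            rounds_to 5 (height_above c F) 1.58931 \<and>
            solid_volume T = 1 / 3 * (sqrt 3 / 4 * (8 / sqrt (10 + 2 * sqrt 5))\<^sup>2)
                         * (2 * sqrt 3 * (3 + sqrt 5) / (3 * sqrt (10 + 2 * sqrt 5))) \<and>
            rounds_to 5 (solid_volume T) 1.01446)"
proof (intro conjI allI impI; (elim conjE)?)
  note M = regular_tetrahedron_measures and R = regular_tetrahedron_roundings
  fix T F and p :: "real^3"
  assume T: "regular_tetrahedron 2 T" "F facet_of T" "p extreme_point_of T" "p \<notin> F"
  show "planar_area F = sqrt 3" "height_above p F = 2 / 3 * sqrt 6" "solid_volume T = 2 / 3 * sqrt 2"
    by (fact M[OF T])+
  show "rounds_to 5 (planar_area F) 1.73205" "rounds_to 5 (height_above p F) 1.63299"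
    "rounds_to 5 (solid_volume T) 0.94281"
    unfolding M[OF T] by (fact R)+
next
  note M = icosahedral_tetrahedron_measures and R = icosahedral_tetrahedron_roundings
  fix c F T assume T: "icosahedral_tetrahedron c F T"
  show "equilateral_triangle (8 / sqrt (10 + 2 * sqrt 5)) F"
    "planar_area F = sqrt 3 / 4 * (8 / sqrt (10 + 2 * sqrt 5))\<^sup>2"
    "height_above c F = 2 * sqrt 3 * (3 + sqrt 5) / (3 * sqrt (10 + 2 * sqrt 5))"
    "solid_volume T = 1 / 3 * (sqrt 3 / 4 * (8 / sqrt (10 + 2 * sqrt 5))\<^sup>2)
                         * (2 * sqrt 3 * (3 + sqrt 5) / (3 * sqrt (10 + 2 * sqrt 5)))"
    using M[OF T] unfolding icosahedral_height_eq by blast+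
  show "rounds_to 4 (8 / sqrt (10 + 2 * sqrt 5)) 2.1029" by (fact R)
  show "rounds_to 5 (planar_area F) 1.91491" "rounds_to 5 (height_above c F) 1.58931"
    "rounds_to 5 (solid_volume T) 1.01446"
    unfolding M(2-4)[OF T] by (fact R)+
qed

end
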